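(* Let $P$ be a topological ring. The assignment $\mathbf{M}_{\_}(P):\mathbf{prosets}_{\mathrm{fin}}\to\mathbf{TopRings}$ sending a locally finite proset $\Lambda$ to $\mathrm{M}_\Lambda(P)$ and an FCC map $f:\Lambda_1\to\Lambda_2$ to $\mathbf{M}[f]:\mathrm{M}_{\Lambda_2}(P)\to\mathrm{M}_{\Lambda_1}(P)$ is a contravariant functor.
   Context: Rings are associative with identity and homomorphisms preserve the identity; topological rings are Hausdorff. $\mathbf{TopRings}$ is the category of topological rings (including the trivial ring) and continuous ring homomorphisms. A proset is a preordered set. For $s_1\preceq s_2$, $[s_1,s_2]=\{s: s_1\preceq s\preceq s_2\}$; a proset is locally finite if all such intervals are finite. Put $\mathcal N_1(s)=\{t: t\preceq s\text{ or }s\preceq t\}$. The components of a proset are the equivalence classes of the relation "joined by a finite chain of elements, each comparable to the next". A subset $\Lambda'\subset\Lambda$ is convex if $[s_1,s_2]\subset\Lambda'$ whenever $s_1\preceq s_2$ are in $\Lambda'$, and for all $s_1,s_2\in\Lambda'$ there are $t_1,\dots,t_n\in\Lambda'$ with $t_1\in\mathcal N_1(s_1)$, $t_{i+1}\in\mathcal N_1(t_i)$, $s_2\in\mathcal N_1(t_n)$. A map $f:\Lambda\to\Lambda'$ of prosets is order preserving if $a\preceq b$ implies $f(a)\preceq f(b)$; a convex function if it is order preserving and maps convex subsets to convex subsets; a convex embedding if it is an injective convex function; constant if its image is a single point. $f$ is FCC if for each component $\Lambda_i$ of $\Lambda$ the restriction $f|_{\Lambda_i}:\Lambda_i\to\Lambda'$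 is either constant or a convex embedding. $\mathbf{prosets}_{\mathrm{fin}}$ is the category of locally finite prosets and FCC maps. For a locally finite proset $\Lambda$, $\mathrm{M}_\Lambda(P)=\{(a_{s_1,s_2})\in P^{\Lambda\times\Lambda}: a_{s_1,s_2}\neq 0\Rightarrow s_1\preceq s_2\}$ with coordinatewise addition, product $(ab)_{s_1,s_2}=\sum_{t\in[s_1,s_2]}a_{s_1,t}b_{t,s_2}$, and the subspace topology from the product space $P^{\Lambda\times\Lambda}$; $\mathrm{M}_\emptyset(P)$ is the trivial ring. For $p\in P$, $p^\Lambda$ is the diagonal matrix with all diagonal entries $p$; $e^{(s_1,s_2)}$ (for $s_1\preceq s_2$) is the matrix with entry $1$ at $(s_1,s_2)$ and $0$ elsewhere; for $S\subset\Lambda$, $1^S=\sum_{s\in S}e^{(s,s)}$ (entrywise). For an FCC map $f:\Lambda_1\to\Lambda_2$, $\mathbf{M}[f]$ is the additive, $P$-linear, continuous extension of $p^{\Lambda_2}\mapsto p^{\Lambda_1}$; $e^{(s,s)}\mapsto 1^{f^{-1}(s)}$; and, for $s_1\neq s_2$, $e^{(s_1,s_2)}\mapsto\sum e^{(t_1,t_2)}$ over all $t_1\preceq t_2$ in $\Lambda_1$ with $f(t_1)=s_1$, $f(t_2)=s_2$ (zero if there are none). Entrywise: $\mathbf{M}[f](A)_{t_1,t_2}$ equals $A_{f(t_1),f(t_1)}$ if $t_1=t_2$, equals $A_{f(t_1),f(t_2)}$ if $t_1\preceq t_2$ and $f(t_1)\neq f(t_2)$, and is $0$ otherwise.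
   Formalization: In the definition of FCC, a constant restriction must also be a convex function, i.e. its value c satisfies [c,c]={c} (automatic for posets); without this M[f] need not be multiplicative, e.g. a point mapped to c in {c,b} with c⪯b⪯c. *)

theory Defs
  imports "HOL-Algebra.Ring" "HOL-Analysis.T1_Spaces" "HOL-Analysis.Function_Topology"
begin

section \<open>Categories and contravariant functors\<close>

text \<open>Hom-sets are indexed by pairs of objects and need not be disjoint; accordingly identities
  and composition take the objects involved as arguments.
  \<open>cat_comp C X Y Z g f\<close> is the composite of \<open>f : X \<rightarrow> Y\<close> followed by \<open>g : Y \<rightarrow> Z\<close>.\<close>

record ('o, 'm) cat =
  obj :: "'o set"
  hom_set :: "'o \<Rightarrow> 'o \<Rightarrow> 'm set"
  ident :: "'o \<Rightarrow> 'm"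
  cat_comp :: "'o \<Rightarrow> 'o \<Rightarrow> 'o \<Rightarrow> 'm \<Rightarrow> 'm \<Rightarrow> 'm"

locale category =
  fixes C :: "('o, 'm) cat"
  assumes ident_in_hom: "X \<in> obj C \<Longrightarrow> ident C X \<in> hom_set C X X"
    and comp_in_hom: "\<lbrakk>X \<in> obj C; Y \<in> obj C; Z \<in> obj C; f \<in> hom_set C X Y; g \<in> hom_set C Y Z\<rbrakk>
      \<Longrightarrow> cat_comp C X Y Z g f \<in> hom_set C X Z"
    and comp_ident_right: "\<lbrakk>X \<in> obj C; Y \<in> obj C; f \<in> hom_set C X Y\<rbrakk>
      \<Longrightarrow> cat_comp C X X Y f (ident C X) = f"
    and comp_ident_left: "\<lbrakk>X \<in> obj C; Y \<in> obj C; f \<in> hom_set C X Y\<rbrakk>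
      \<Longrightarrow> cat_comp C X Y Y (ident C Y) f = f"
    and comp_assoc: "\<lbrakk>W \<in> obj C; X \<in> obj C; Y \<in> obj C; Z \<in> obj C;
        f \<in> hom_set C W X; g \<in> hom_set C X Y; h \<in> hom_set C Y Z\<rbrakk>
      \<Longrightarrow> cat_comp C W X Z (cat_comp C X Y Z h g) f = cat_comp C W Y Z h (cat_comp C W X Y g f)"

locale contravariant_functor = C: category C + D: category D
  for C :: "('o, 'm) cat" and D :: "('p, 'n) cat" +
  fixes F_obj :: "'o \<Rightarrow> 'p"
    and F_map :: "'o \<Rightarrow> 'o \<Rightarrow> 'm \<Rightarrow> 'n"
  assumes F_obj_in: "X \<in> obj C \<Longrightarrow> F_obj X \<in> obj D"
    and F_map_in: "\<lbrakk>X \<in> obj C; Y \<in> obj C; f \<in> hom_set C X Y\<rbrakk>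
      \<Longrightarrow> F_map X Y f \<in> hom_set D (F_obj Y) (F_obj X)"
    and F_map_ident: "X \<in> obj C \<Longrightarrow> F_map X X (ident C X) = ident D (F_obj X)"
    and F_map_comp: "\<lbrakk>X \<in> obj C; Y \<in> obj C; Z \<in> obj C; f \<in> hom_set C X Y; g \<in> hom_set C Y Z\<rbrakk>
      \<Longrightarrow> F_map X Z (cat_comp C X Y Z g f)
          = cat_comp D (F_obj Z) (F_obj Y) (F_obj X) (F_map X Y f) (F_map Y Z g)"


section \<open>Topological rings\<close>

record 'a top_ring = "'a ring" +
  topo :: "'a topology"

definition topological_ring :: "'a top_ring \<Rightarrow> bool" where
  "topological_ring R \<longleftrightarrow>
     ring R \<and> topspace (topo R) = carrier R \<and> Hausdorff_space (topo R) \<and>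
     continuous_map (prod_topology (topo R) (topo R)) (topo R) (\<lambda>(x, y). x \<oplus>\<^bsub>R\<^esub> y) \<and>
     continuous_map (topo R) (topo R) (\<lambda>x. \<ominus>\<^bsub>R\<^esub> x) \<and>
     continuous_map (prod_topology (topo R) (topo R)) (topo R) (\<lambda>(x, y). x \<otimes>\<^bsub>R\<^esub> y)"

text \<open>In both categories below a morphism is a function that is \<open>undefined\<close> outside the carrier
  of its domain, so that equality of morphisms is equality on that carrier.\<close>

definition TopRings :: "('a top_ring, 'a \<Rightarrow> 'a) cat" where
  "TopRings = \<lparr>
     obj = {R. topological_ring R},
     hom_set = (\<lambda>R S. {h \<in> ring_hom R S. continuous_map (topo R) (topo S) h}
                       \<inter> extensional (carrier R)),
     ident = (\<lambda>R. restrict (\<lambda>x. x) (carrier R)),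
     cat_comp = (\<lambda>R S T h g. compose (carrier R) h g)\<rparr>"


section \<open>Prosets and FCC maps\<close>

record 'a proset = "'a partial_object" +
  leq :: "'a rel"

definition is_proset :: "'a proset \<Rightarrow> bool" where
  "is_proset L \<longleftrightarrow> preorder_on (carrier L) (leq L)"

definition proset_interval :: "'a proset \<Rightarrow> 'a \<Rightarrow> 'a \<Rightarrow> 'a set" where
  "proset_interval L s1 s2 = {s \<in> carrier L. (s1, s) \<in> leq L \<and> (s, s2) \<in> leq L}"

definition locally_finite_proset :: "'a proset \<Rightarrow> bool" where
  "locally_finite_proset L \<longleftrightarrow>
     is_proset L \<and> (\<forall>(s1, s2) \<in> leq L. finite (proset_interval L s1 s2))"

definition nbhd1 :: "'a proset \<Rightarrow> 'a \<Rightarrow> 'a set" where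
  "nbhd1 L s = {t \<in> carrier L. (t, s) \<in> leq L \<or> (s, t) \<in> leq L}"

text \<open>The transitive closure is reflexive on the carrier because \<open>leq L\<close> is.\<close>

definition proset_components :: "'a proset \<Rightarrow> 'a set set" where
  "proset_components L = carrier L // (leq L \<union> (leq L)\<inverse>)\<^sup>+"

definition proset_convex :: "'a proset \<Rightarrow> 'a set \<Rightarrow> bool" where
  "proset_convex L X \<longleftrightarrow>
     X \<subseteq> carrier L \<and>
     (\<forall>s1 \<in> X. \<forall>s2 \<in> X. (s1, s2) \<in> leq L \<longrightarrow> proset_interval L s1 s2 \<subseteq> X) \<and>
     (\<forall>s1 \<in> X. \<forall>s2 \<in> X. \<exists>ts. ts \<noteq> [] \<and> set ts \<subseteq> X \<and>
        hd ts \<in> nbhd1 L s1 \<and>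
        (\<forall>i. Suc i < length ts \<longrightarrow> ts ! Suc i \<in> nbhd1 L (ts ! i)) \<and>
        s2 \<in> nbhd1 L (last ts))"

definition subproset :: "'a proset \<Rightarrow> 'a set \<Rightarrow> 'a proset" where
  "subproset L X = \<lparr>carrier = X, leq = leq L \<inter> X \<times> X\<rparr>"

definition order_preserving :: "'a proset \<Rightarrow> 'b proset \<Rightarrow> ('a \<Rightarrow> 'b) \<Rightarrow> bool" where
  "order_preserving L L' f \<longleftrightarrow>
     f \<in> carrier L \<rightarrow> carrier L' \<and> (\<forall>(a, b) \<in> leq L. (f a, f b) \<in> leq L')"

definition convex_function :: "'a proset \<Rightarrow> 'b proset \<Rightarrow> ('a \<Rightarrow> 'b) \<Rightarrow> bool" where
  "convex_function L L' f \<longleftrightarrow>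
     order_preserving L L' f \<and> (\<forall>X. proset_convex L X \<longrightarrow> proset_convex L' (f ` X))"

definition convex_embedding :: "'a proset \<Rightarrow> 'b proset \<Rightarrow> ('a \<Rightarrow> 'b) \<Rightarrow> bool" where
  "convex_embedding L L' f \<longleftrightarrow> convex_function L L' f \<and> inj_on f (carrier L)"

text \<open>Being constant is read as a property of convex functions, like being an embedding. For
  posets this is no restriction, since points of posets are convex. In general it says that the
  value \<open>c\<close> satisfies \<open>[c, c] = {c}\<close>. Without this the induced maps of matrix rings are not
  multiplicative: if \<open>c \<noteq> b\<close>, \<open>c \<preceq> b \<preceq> c\<close> and \<open>f\<close> has constant value \<open>c\<close> on a component, then
  at diagonal positions in that component \<open>\<^bold>M[f]\<close> sends \<open>e\<^bsup>(c,b)\<^esup> e\<^bsup>(b,c)\<^esup> = e\<^bsup>(c,c)\<^esup>\<close> to 1,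
  while both factors are sent to 0 there.\<close>

definition constant_function :: "'a proset \<Rightarrow> 'b proset \<Rightarrow> ('a \<Rightarrow> 'b) \<Rightarrow> bool" where
  "constant_function L L' f \<longleftrightarrow> convex_function L L' f \<and> (\<exists>c. f ` carrier L = {c})"

definition FCC :: "'a proset \<Rightarrow> 'b proset \<Rightarrow> ('a \<Rightarrow> 'b) \<Rightarrow> bool" where
  "FCC L L' f \<longleftrightarrow>
     f \<in> carrier L \<rightarrow> carrier L' \<and>
     (\<forall>K \<in> proset_components L.
        constant_function (subproset L K) L' f \<or> convex_embedding (subproset L K) L' f)"

definition prosets_fin :: "('a proset, 'a \<Rightarrow> 'a) cat" where
  "prosets_fin = \<lparr>
     obj = {L. locally_finite_proset L},
     hom_set = (\<lambda>L L'. {f. FCC L L' f} \<inter> extensional (carrier L)),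
     ident = (\<lambda>L. restrict (\<lambda>x. x) (carrier L)),
     cat_comp = (\<lambda>L L' L'' g f. compose (carrier L) g f)\<rparr>"


section \<open>Generalized matrix rings\<close>

text \<open>Matrices are \<open>undefined\<close> outside \<open>\<Lambda> \<times> \<Lambda>\<close>, as required by \<^const>\<open>product_topology\<close>.
  If \<open>s1 \<preceq> s2\<close> fails then \<open>[s1, s2]\<close> is empty and the product has entry 0 at \<open>(s1, s2)\<close>.\<close>

definition matrix_carrier :: "'a proset \<Rightarrow> 'p top_ring \<Rightarrow> ('a \<times> 'a \<Rightarrow> 'p) set" where
  "matrix_carrier L P =
     {A \<in> (carrier L \<times> carrier L) \<rightarrow>\<^sub>E carrier P.
        \<forall>s1 \<in> carrier L. \<forall>s2 \<in> carrier L. A (s1, s2) \<noteq> \<zero>\<^bsub>P\<^esub> \<longrightarrow> (s1, s2) \<in> leq L}"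

definition matrix_ring :: "'p top_ring \<Rightarrow> 'a proset \<Rightarrow> ('a \<times> 'a \<Rightarrow> 'p) top_ring" where
  "matrix_ring P L = \<lparr>
     carrier = matrix_carrier L P,
     mult = (\<lambda>A B. \<lambda>(s1, s2) \<in> carrier L \<times> carrier L.
               \<Oplus>\<^bsub>P\<^esub>t \<in> proset_interval L s1 s2. A (s1, t) \<otimes>\<^bsub>P\<^esub> B (t, s2)),
     one = (\<lambda>(s1, s2) \<in> carrier L \<times> carrier L. if s1 = s2 then \<one>\<^bsub>P\<^esub> else \<zero>\<^bsub>P\<^esub>),
     zero = (\<lambda>(s1, s2) \<in> carrier L \<times> carrier L. \<zero>\<^bsub>P\<^esub>),
     add = (\<lambda>A B. \<lambda>(s1, s2) \<in> carrier L \<times> carrier L. A (s1, s2) \<oplus>\<^bsub>P\<^esub> B (s1, s2)),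
     topo = subtopology (product_topology (\<lambda>_. topo P) (carrier L \<times> carrier L))
              (matrix_carrier L P)\<rparr>"

definition matrix_map ::
  "'p top_ring \<Rightarrow> 'a proset \<Rightarrow> 'b proset \<Rightarrow> ('a \<Rightarrow> 'b) \<Rightarrow> ('b \<times> 'b \<Rightarrow> 'p) \<Rightarrow> ('a \<times> 'a \<Rightarrow> 'p)" where
  "matrix_map P L1 L2 f =
     (\<lambda>A \<in> carrier (matrix_ring P L2). \<lambda>(t1, t2) \<in> carrier L1 \<times> carrier L1.
        if t1 = t2 then A (f t1, f t1)
        else if (t1, t2) \<in> leq L1 \<and> f t1 \<noteq> f t2 then A (f t1, f t2)
        else \<zero>\<^bsub>P\<^esub>)"

text \<open>The next lemmas confirm that \<^const>\<open>matrix_map\<close> takes the prescribed values on the scalar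
  matrices \<open>p\<^sup>\<Lambda>\<close>, the diagonal units \<open>e\<^bsup>(s,s)\<^esup>\<close> and the off-diagonal units \<open>e\<^bsup>(s1,s2)\<^esup>\<close>, the (possibly
  infinite) sums of matrix units being taken entrywise.\<close>

definition scalar_matrix :: "'p top_ring \<Rightarrow> 'a proset \<Rightarrow> 'p \<Rightarrow> ('a \<times> 'a \<Rightarrow> 'p)" where
  "scalar_matrix P L p =
     (\<lambda>(s1, s2) \<in> carrier L \<times> carrier L. if s1 = s2 then p else \<zero>\<^bsub>P\<^esub>)"

definition unit_sum :: "'p top_ring \<Rightarrow> 'a proset \<Rightarrow> ('a \<times> 'a) set \<Rightarrow> ('a \<times> 'a \<Rightarrow> 'p)" where
  "unit_sum P L U = (\<lambda>x \<in> carrier L \<times> carrier L. if x \<in> U then \<one>\<^bsub>P\<^esub> else \<zero>\<^bsub>P\<^esub>)"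

lemma scalar_matrix_in_carrier:
  assumes "ring P" "is_proset L" "p \<in> carrier P"
  shows "scalar_matrix P L p \<in> carrier (matrix_ring P L)"
  using assms ring.ring_simprules(2)[OF assms(1)]
  by (auto simp: scalar_matrix_def matrix_ring_def matrix_carrier_def is_proset_def
      preorder_on_def refl_on_def)

lemma unit_sum_in_carrier:
  assumes "ring P" "U \<subseteq> leq L"
  shows "unit_sum P L U \<in> carrier (matrix_ring P L)"
  using assms ring.ring_simprules(2,6)[OF assms(1)]
  by (auto simp: unit_sum_def matrix_ring_def matrix_carrier_def)

lemma matrix_map_apply:
  assumes "A \<in> carrier (matrix_ring P L2)"
  shows "matrix_map P L1 L2 f A =
     (\<lambda>(t1, t2) \<in> carrier L1 \<times> carrier L1.
        if t1 = t2 then A (f t1, f t1)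
        else if (t1, t2) \<in> leq L1 \<and> f t1 \<noteq> f t2 then A (f t1, f t2)
        else \<zero>\<^bsub>P\<^esub>)"
  using assms by (simp add: matrix_map_def)

lemma matrix_map_scalar_matrix:
  assumes "ring P" "is_proset L2" "p \<in> carrier P" "f \<in> carrier L1 \<rightarrow> carrier L2"
  shows "matrix_map P L1 L2 f (scalar_matrix P L2 p) = scalar_matrix P L1 p"
  unfolding matrix_map_apply[OF scalar_matrix_in_carrier[OF assms(1,2,3)]]
  using assms(4) by (auto simp: fun_eq_iff restrict_def scalar_matrix_def Pi_iff)

lemma matrix_map_diagonal_unit:
  assumes "ring P" "is_proset L2" "s \<in> carrier L2" "f \<in> carrier L1 \<rightarrow> carrier L2"
  shows "matrix_map P L1 L2 f (unit_sum P L2 {(s, s)})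
    = unit_sum P L1 {(t, t) |t. t \<in> carrier L1 \<and> f t = s}"
proof -
  have "{(s, s)} \<subseteq> leq L2"
    using assms(2,3) by (auto simp: is_proset_def preorder_on_def refl_on_def)
  note eq = matrix_map_apply[OF unit_sum_in_carrier[OF assms(1) this]]
  show ?thesis
    unfolding eq using assms(4) by (auto simp: fun_eq_iff restrict_def unit_sum_def Pi_iff)
qed

lemma matrix_map_off_diagonal_unit:
  assumes "ring P" "(s1, s2) \<in> leq L2" "s1 \<noteq> s2" "f \<in> carrier L1 \<rightarrow> carrier L2"
  shows "matrix_map P L1 L2 f (unit_sum P L2 {(s1, s2)})
    = unit_sum P L1 {(t1, t2). (t1, t2) \<in> leq L1 \<and> f t1 = s1 \<and> f t2 = s2}"
proof -
  have "{(s1, s2)} \<subseteq> leq L2" using assms(2) by simp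
  note eq = matrix_map_apply[OF unit_sum_in_carrier[OF assms(1) this]]
  show ?thesis
    unfolding eq using assms(3,4) by (auto simp: fun_eq_iff restrict_def unit_sum_def Pi_iff)
qed

end

(* The crux is the multiplicativity of M[f]. If s \<preceq> t then [s, t] is a convex set inside one
   component, so f maps it onto [f(s), f(t)] and is injective or constant on it. In the first case f
   merely reindexes the sum defining (AB)(f(s), f(t)). In the second case [f(s), f(s)] = {f(s)}, and
   as M[f] vanishes at off-diagonal positions with equal images, both sides are A(f(s), f(s))
   B(f(s), f(s)) if s = t, and 0 otherwise. *)

theory Submission
  imports Defs
begin

section \<open>The category of locally finite prosets\<close>

text \<open>The order need not be antisymmetric, so [s, s] may contain many points and even a
  diagonal entry of a product can be a sum of several terms. This makes the constant case delicate:
  it needs [c, c] = {c} for the constant value c, and obtains it because a constant piece is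
  required to be a convex function, so that the image of [s, t] fills [c, c]. The FCC condition
  lives on the components, with convexity tested in \<open>subproset L K\<close>, whereas matrix
  products run over intervals of the whole proset. The two viewpoints agree because a component is
  closed under comparability.\<close>

lemma leq_carrier:
  assumes "is_proset L" "(s, t) \<in> leq L"
  shows "s \<in> carrier L" "t \<in> carrier L"
  using assms by (auto simp: is_proset_def preorder_on_def refl_on_def)

lemma leq_refl: "is_proset L \<Longrightarrow> s \<in> carrier L \<Longrightarrow> (s, s) \<in> leq L"
  by (auto simp: is_proset_def preorder_on_def refl_on_def)

lemma leq_trans: "is_proset L \<Longrightarrow> (s, t) \<in> leq L \<Longrightarrow> (t, u) \<in> leq L \<Longrightarrow> (s, u) \<in> leq L"
  by (auto simp: is_proset_def preorder_on_def dest: transD)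

section \<open>Components of a proset and convexity inside them\<close>

lemma component_subset:
  assumes "is_proset L" "K \<in> proset_components L"
  shows "K \<subseteq> carrier L"
proof -
  have "leq L \<union> (leq L)\<inverse> \<subseteq> carrier L \<times> carrier L"
    using leq_carrier[OF assms(1)] by auto
  then have "(leq L \<union> (leq L)\<inverse>)\<^sup>+ \<subseteq> carrier L \<times> carrier L"
    by (rule trancl_subset_Sigma)
  then show ?thesis
    using assms(2) by (auto simp: proset_components_def quotient_def)
qed

lemma component_closed:
  assumes "K \<in> proset_components L" "s \<in> K" "(s, t) \<in> leq L \<or> (t, s) \<in> leq L"
  shows "t \<in> K"
proof -
  obtain x where x: "K = (leq L \<union> (leq L)\<inverse>)\<^sup>+ `` {x}"
    using assms(1) by (auto simp: proset_components_def quotient_def)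
  then show ?thesis
    using assms(2,3) by (fastforce intro: trancl_into_trancl)
qed

lemma component_exists:
  assumes "is_proset L" "t \<in> carrier L"
  obtains K where "K \<in> proset_components L" "t \<in> K"
proof
  show "(leq L \<union> (leq L)\<inverse>)\<^sup>+ `` {t} \<in> proset_components L"
    using assms(2) by (auto simp: proset_components_def quotient_def)
  show "t \<in> (leq L \<union> (leq L)\<inverse>)\<^sup>+ `` {t}"
    using leq_refl[OF assms] by auto
qed

lemma component_nonempty:
  assumes "is_proset L" "K \<in> proset_components L"
  shows "K \<noteq> {}"
  using assms leq_refl[OF assms(1)] by (fastforce simp: proset_components_def quotient_def)

text \<open>A chain of comparable elements starting at a point x of K never leaves K, so
  monotonicity on K alone carries each of its links to a pair of comparable elements of
  \<open>L'\<close>. Induction along the chain puts the whole image of K into the class of f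
  x.\<close>

lemma component_image:
  assumes L: "is_proset L" and K: "K \<in> proset_components L"
    and f: "order_preserving (subproset L K) L' f"
  obtains K' where "K' \<in> proset_components L'" "f ` K \<subseteq> K'"
proof -
  obtain x where x: "x \<in> carrier L" and Kx: "K = (leq L \<union> (leq L)\<inverse>)\<^sup>+ `` {x}"
    using K by (auto simp: proset_components_def quotient_def)
  have xK: "x \<in> K"
    using leq_refl[OF L x] Kx by auto
  have "(f x, f y) \<in> (leq L' \<union> (leq L')\<inverse>)\<^sup>+" if "(x, y) \<in> (leq L \<union> (leq L)\<inverse>)\<^sup>+" for y
    using that
  proof (induction rule: trancl_induct)
    case (base y)
    moreover from this have "y \<in> K"
      using Kx by auto
    ultimately show ?case
      using f xK by (fastforce simp: order_preserving_def subproset_def)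
  next
    case (step y z)
    then have y: "y \<in> K"
      using Kx by auto
    moreover from this have "z \<in> K"
      using component_closed[OF K] step by blast
    ultimately have "(f y, f z) \<in> leq L' \<union> (leq L')\<inverse>"
      using f step by (fastforce simp: order_preserving_def subproset_def)
    then show ?case
      using step.IH by (rule trancl_into_trancl[rotated])
  qed
  then have "f ` K \<subseteq> (leq L' \<union> (leq L')\<inverse>)\<^sup>+ `` {f x}"
    using Kx by auto
  moreover have "f x \<in> carrier L'"
    using f xK by (auto simp: order_preserving_def subproset_def)
  then have "(leq L' \<union> (leq L')\<inverse>)\<^sup>+ `` {f x} \<in> proset_components L'"
    by (auto simp: proset_components_def quotient_def)
  ultimately show thesis
    using that by blast
qed

text \<open>Everything comparable to a point of K lies in K, so intervals between points of K and
  neighbourhoods of such points are the same in \<open>L\<close> and in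
  \<open>subproset L K\<close>. This translates between convexity in a component, where FCC is
  stated, and convexity in the proset, where the intervals of the matrix product live.\<close>

lemma convex_subproset_iff:
  assumes L: "is_proset L" and K: "K \<in> proset_components L"
  shows "proset_convex (subproset L K) X \<longleftrightarrow> proset_convex L X \<and> X \<subseteq> K"
proof -
  have KL: "K \<subseteq> carrier L"
    by (rule component_subset[OF L K])
  have interval: "proset_interval (subproset L K) s1 s2 = proset_interval L s1 s2"
    if "s1 \<in> K" "s2 \<in> K" for s1 s2
    using that KL component_closed[OF K]
    by (auto simp: proset_interval_def subproset_def)
  have nbhd: "nbhd1 (subproset L K) s = nbhd1 L s" if "s \<in> K" for s
    using that KL component_closed[OF K] by (auto simp: nbhd1_def subproset_def)
  have chain: "(ts \<noteq> [] \<and> set ts \<subseteq> X \<and> hd ts \<in> nbhd1 (subproset L K) s1 \<and>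
        (\<forall>i. Suc i < length ts \<longrightarrow> ts ! Suc i \<in> nbhd1 (subproset L K) (ts ! i)) \<and>
        s2 \<in> nbhd1 (subproset L K) (last ts)) \<longleftrightarrow>
      (ts \<noteq> [] \<and> set ts \<subseteq> X \<and> hd ts \<in> nbhd1 L s1 \<and>
        (\<forall>i. Suc i < length ts \<longrightarrow> ts ! Suc i \<in> nbhd1 L (ts ! i)) \<and>
        s2 \<in> nbhd1 L (last ts))"
    if X: "X \<subseteq> K" and s1: "s1 \<in> X" for ts s1 s2
  proof -
    have "nbhd1 (subproset L K) (last ts) = nbhd1 L (last ts)" if "ts \<noteq> []" "set ts \<subseteq> X"
      using nbhd last_in_set[OF that(1)] that(2) X by blast
    moreover have "nbhd1 (subproset L K) (ts ! i) = nbhd1 L (ts ! i)"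
      if "set ts \<subseteq> X" "Suc i < length ts" for i
    proof -
      have "ts ! i \<in> set ts"
        using that(2) by simp
      then show ?thesis
        using nbhd that(1) X by blast
    qed
    moreover have "nbhd1 (subproset L K) s1 = nbhd1 L s1"
      using nbhd X s1 by blast
    ultimately show ?thesis
      by auto
  qed
  have leq: "(s1, s2) \<in> leq (subproset L K) \<longleftrightarrow> (s1, s2) \<in> leq L" if "s1 \<in> K" "s2 \<in> K" for s1 s2
    using that by (simp add: subproset_def)
  show ?thesis
  proof (cases "X \<subseteq> K")
    case True
    have "(s1, s2) \<in> leq (subproset L K) \<longleftrightarrow> (s1, s2) \<in> leq L"
      "proset_interval (subproset L K) s1 s2 = proset_interval L s1 s2"
      if "s1 \<in> X" "s2 \<in> X" for s1 s2
      using that True leq interval by blast+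
    moreover have "X \<subseteq> carrier (subproset L K)" "X \<subseteq> carrier L"
      using True KL by (auto simp: subproset_def)
    ultimately show ?thesis
      using True by (simp add: proset_convex_def chain[OF True])
  next
    case False
    then show ?thesis
      by (simp add: proset_convex_def subproset_def)
  qed
qed

text \<open>The left endpoint s1 is comparable to every element of the interval, so the one-element
  list [s1] links any two of them; transitivity keeps subintervals inside.\<close>

lemma interval_convex:
  assumes L: "is_proset L" and "(s1, s2) \<in> leq L"
  shows "proset_convex L (proset_interval L s1 s2)"
proof -
  have s1: "s1 \<in> proset_interval L s1 s2"
    using assms leq_refl[OF L] leq_carrier[OF assms] by (auto simp: proset_interval_def)
  have "\<exists>ts. ts \<noteq> [] \<and> set ts \<subseteq> proset_interval L s1 s2 \<and> hd ts \<in> nbhd1 L x \<and>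
        (\<forall>i. Suc i < length ts \<longrightarrow> ts ! Suc i \<in> nbhd1 L (ts ! i)) \<and> y \<in> nbhd1 L (last ts)"
    if "x \<in> proset_interval L s1 s2" "y \<in> proset_interval L s1 s2" for x y
    using that s1 by (intro exI[of _ "[s1]"]) (auto simp: nbhd1_def proset_interval_def)
  moreover have "proset_interval L x y \<subseteq> proset_interval L s1 s2"
    if "x \<in> proset_interval L s1 s2" "y \<in> proset_interval L s1 s2" for x y
    using that leq_trans[OF L, of s1 x] leq_trans[OF L, of _ y s2]
    by (auto simp: proset_interval_def)
  moreover have "proset_interval L s1 s2 \<subseteq> carrier L"
    by (auto simp: proset_interval_def)
  ultimately show ?thesis
    unfolding proset_convex_def by blast
qed

section \<open>FCC maps on comparable elements and on intervals\<close>

lemma FCC_order_preserving: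
  assumes L: "is_proset L" and f: "FCC L L' f"
  shows "order_preserving L L' f"
proof -
  have "(f a, f b) \<in> leq L'" if ab: "(a, b) \<in> leq L" for a b
  proof -
    \<comment> \<open>Two comparable elements share a component, and both kinds of pieces of f are
      order preserving there.\<close>
    obtain K where K: "K \<in> proset_components L" "a \<in> K"
      by (rule component_exists[OF L leq_carrier(1)[OF L ab]])
    then have "b \<in> K"
      using component_closed[OF K] ab by blast
    moreover have "constant_function (subproset L K) L' f \<or> convex_embedding (subproset L K) L' f"
      using f K by (simp add: FCC_def)
    then have "order_preserving (subproset L K) L' f"
      by (auto simp only: constant_function_def convex_embedding_def convex_function_def)
    ultimately show ?thesis
      using K ab by (auto simp: order_preserving_def subproset_def)
  qed
  then show ?thesis
    using f by (auto simp: FCC_def order_preserving_def)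
qed

lemma FCC_interval:
  assumes L: "is_proset L" and f: "FCC L L' f" and st: "(s, t) \<in> leq L"
  shows "f ` proset_interval L s t = proset_interval L' (f s) (f t)"
    and "inj_on f (proset_interval L s t) \<or> (\<forall>u \<in> proset_interval L s t. f u = f s)"
proof -
  let ?I = "proset_interval L s t"
  obtain K where K: "K \<in> proset_components L" "s \<in> K"
    by (rule component_exists[OF L leq_carrier(1)[OF L st]])
  have IK: "?I \<subseteq> K"
    using component_closed[OF K] by (auto simp: proset_interval_def)
  have mem: "s \<in> ?I" "t \<in> ?I"
    using st leq_refl[OF L] leq_carrier[OF L st] by (auto simp: proset_interval_def)
  have fK: "constant_function (subproset L K) L' f \<or> convex_embedding (subproset L K) L' f"
    using f K by (auto simp: FCC_def)
  show "inj_on f ?I \<or> (\<forall>u \<in> ?I. f u = f s)"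
    using fK
  proof
    assume "constant_function (subproset L K) L' f"
    then obtain c where "f ` K = {c}"
      by (auto simp: constant_function_def subproset_def)
    then have c: "f u = c" if "u \<in> K" for u
      using that by blast
    have "\<forall>u \<in> ?I. f u = f s"
      using IK by (simp add: c[OF K(2)] c[OF subsetD])
    then show ?thesis ..
  next
    assume "convex_embedding (subproset L K) L' f"
    then show ?thesis
      using IK by (auto simp: convex_embedding_def subproset_def intro: inj_on_subset)
  qed
  have ord: "(f a, f b) \<in> leq L'" if "(a, b) \<in> leq L" for a b
    using FCC_order_preserving[OF L f] that by (auto simp: order_preserving_def)
  have "proset_convex (subproset L K) ?I"
    using convex_subproset_iff[OF L K(1)] interval_convex[OF L st] IK by blast
  moreover have "convex_function (subproset L K) L' f"
    using fK by (auto simp: constant_function_def convex_embedding_def)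
  ultimately have "proset_convex L' (f ` ?I)"
    by (simp add: convex_function_def)
  \<comment> \<open>The image is convex and contains f s \<preceq> f t, so it contains the whole
    interval between them. Order preservation alone gives only the opposite inclusion.\<close>
  then have "proset_interval L' (f s) (f t) \<subseteq> f ` ?I"
    using mem ord[OF st] by (simp add: proset_convex_def)
  moreover have "f ` ?I \<subseteq> proset_interval L' (f s) (f t)"
    using FCC_order_preserving[OF L f] by (auto simp: order_preserving_def proset_interval_def)
  ultimately show "f ` ?I = proset_interval L' (f s) (f t)"
    by blast
qed

text \<open>Morphisms are extensional, so identities and composites appear as
  \<open>restrict\<close> and \<open>compose\<close>. Since only values on the carrier matter for
  FCC, the condition can be verified on plain functions and transferred.\<close>

lemma FCC_cong:
  assumes L: "is_proset L" and eq: "\<And>x. x \<in> carrier L \<Longrightarrow> f x = g x"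
  shows "FCC L L' f \<longleftrightarrow> FCC L L' g"
proof -
  have "(constant_function (subproset L K) L' f \<or> convex_embedding (subproset L K) L' f) \<longleftrightarrow>
      (constant_function (subproset L K) L' g \<or> convex_embedding (subproset L K) L' g)"
    if "K \<in> proset_components L" for K
  proof -
    have eqK: "f x = g x" if "x \<in> K" for x
      using eq component_subset[OF L \<open>K \<in> proset_components L\<close>] that by blast
    have img: "f ` X = g ` X" if "X \<subseteq> K" for X
      using eqK that by (auto intro!: image_cong)
    have "(\<forall>(a, b) \<in> leq (subproset L K). (f a, f b) \<in> leq L') \<longleftrightarrow>
        (\<forall>(a, b) \<in> leq (subproset L K). (g a, g b) \<in> leq L')"
      by (intro ball_cong) (auto simp: subproset_def eqK)
    then have "order_preserving (subproset L K) L' f \<longleftrightarrow> order_preserving (subproset L K) L' g"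
      by (simp add: order_preserving_def subproset_def Pi_iff eqK)
    moreover have "proset_convex L' (f ` X) \<longleftrightarrow> proset_convex L' (g ` X)"
      if "proset_convex (subproset L K) X" for X
    proof -
      have "X \<subseteq> K"
        using that by (simp add: proset_convex_def subproset_def)
      then show ?thesis
        by (simp add: img)
    qed
    ultimately have "convex_function (subproset L K) L' f \<longleftrightarrow> convex_function (subproset L K) L' g"
      unfolding convex_function_def by blast
    moreover have "inj_on f K \<longleftrightarrow> inj_on g K"
      using eqK by (rule inj_on_cong)
    ultimately show ?thesis
      using img[of K] by (simp add: constant_function_def convex_embedding_def subproset_def)
  qed
  then show ?thesis
    using eq by (auto simp: FCC_def Pi_iff)
qed

section \<open>Identities and composites of FCC maps\<close>

lemma FCC_id:
  assumes L: "is_proset L"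
  shows "FCC L L (\<lambda>x. x)"
proof -
  have "convex_embedding (subproset L K) L (\<lambda>x. x)" if K: "K \<in> proset_components L" for K
    using component_subset[OF L K] convex_subproset_iff[OF L K]
    by (auto simp: convex_embedding_def convex_function_def order_preserving_def subproset_def)
  then show ?thesis
    by (simp add: FCC_def)
qed

text \<open>On a component K the map f has values in one component K', where g is constant or
  injective; the composite is constant if either piece is, and injective otherwise. Convexity passes
  through K': the image of a convex subset of K is convex in \<open>L'\<close>, hence in
  \<open>subproset L' K'\<close>, where the hypothesis on g applies.\<close>

lemma FCC_compose:
  assumes L: "is_proset L" and L': "is_proset L'"
    and f: "FCC L L' f" and g: "FCC L' L'' g"
  shows "FCC L L'' (g \<circ> f)"
proof -
  have ord: "order_preserving L L'' (g \<circ> f)"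
    unfolding order_preserving_def
  proof (intro conjI ballI)
    show "g \<circ> f \<in> carrier L \<rightarrow> carrier L''"
      using f g by (auto simp: FCC_def)
    fix x assume "x \<in> leq L"
    then have "case x of (a, b) \<Rightarrow> (f a, f b) \<in> leq L'"
      using FCC_order_preserving[OF L f] by (simp add: order_preserving_def)
    then show "case x of (a, b) \<Rightarrow> ((g \<circ> f) a, (g \<circ> f) b) \<in> leq L''"
      using FCC_order_preserving[OF L' g] by (cases x) (auto simp: order_preserving_def)
  qed
  have "constant_function (subproset L K) L'' (g \<circ> f) \<or> convex_embedding (subproset L K) L'' (g \<circ> f)"
    if K: "K \<in> proset_components L" for K
  proof -
    have fK: "constant_function (subproset L K) L' f \<or> convex_embedding (subproset L K) L' f"
      using f K by (auto simp: FCC_def)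
    then have cf: "convex_function (subproset L K) L' f"
      by (auto simp: constant_function_def convex_embedding_def)
    then obtain K' where K': "K' \<in> proset_components L'" "f ` K \<subseteq> K'"
      using component_image[OF L K] by (auto simp: convex_function_def)
    have gK': "constant_function (subproset L' K') L'' g \<or> convex_embedding (subproset L' K') L'' g"
      using g K' by (auto simp: FCC_def)
    then have cg: "convex_function (subproset L' K') L'' g"
      by (auto simp: constant_function_def convex_embedding_def)
    have conv: "proset_convex L'' ((g \<circ> f) ` X)" if X: "proset_convex (subproset L K) X" for X
    proof -
      have "X \<subseteq> K"
        using X by (simp add: proset_convex_def subproset_def)
      then have "f ` X \<subseteq> K'"
        using K'(2) by blast
      moreover have "proset_convex L' (f ` X)"
        using cf X by (simp add: convex_function_def)
      ultimately have "proset_convex (subproset L' K') (f ` X)"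
        using convex_subproset_iff[OF L' K'(1)] by blast
      then show ?thesis
        unfolding image_comp[symmetric] using cg by (simp add: convex_function_def)
    qed
    have "order_preserving (subproset L K) L'' (g \<circ> f)"
      using ord component_subset[OF L K] by (auto simp: order_preserving_def subproset_def)
    then have cgf: "convex_function (subproset L K) L'' (g \<circ> f)"
      using conv by (simp add: convex_function_def)
    \<comment> \<open>A constant piece must have exactly one value. If g is constant on K', this
      takes a point of K, since an empty K would have an empty image.\<close>
    have ne: "K \<noteq> {}"
      by (rule component_nonempty[OF L K])
    consider (const_f) c where "f ` K = {c}" | (const_g) c where "g ` K' = {c}"
      | (inj) "inj_on f K" "inj_on g K'"
      using fK gK' by (auto simp: constant_function_def convex_embedding_def subproset_def)
    then show ?thesis
    proof cases
      case const_f
      then have "(g \<circ> f) ` K = {g c}"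
        unfolding image_comp[symmetric] by simp
      then show ?thesis
        using cgf by (auto simp: constant_function_def subproset_def)
    next
      case const_g
      then have "(g \<circ> f) ` K = {c}"
        using K'(2) ne by (metis image_comp image_is_empty image_mono subset_singletonD)
      then show ?thesis
        using cgf by (auto simp: constant_function_def subproset_def)
    next
      case inj
      then have "inj_on (g \<circ> f) K"
        using K'(2) by (auto intro: comp_inj_on inj_on_subset)
      then show ?thesis
        using cgf by (auto simp: convex_embedding_def subproset_def)
    qed
  qed
  then show ?thesis
    using ord by (simp add: FCC_def order_preserving_def)
qed

lemma FCC_funcset: "FCC L L' f \<Longrightarrow> f \<in> carrier L \<rightarrow> carrier L'"
  by (simp add: FCC_def)

section \<open>Extensional functions and the two categories\<close>

lemma compose_restrict_id:
  assumes "f \<in> extensional A" "f \<in> A \<rightarrow> B"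
  shows "compose A f (restrict (\<lambda>x. x) A) = f" "compose A (restrict (\<lambda>x. x) B) f = f"
  using assms by (intro extensionalityI[of _ A f]; simp add: compose_def Pi_iff)+

lemma compose_compose:
  assumes "f \<in> A \<rightarrow> B"
  shows "compose A (compose B h g) f = compose A h (compose A g f)"
  using assms by (intro extensionalityI[of _ A]) (simp_all add: compose_def Pi_iff)

lemma category_prosets_fin: "category prosets_fin"
proof
  fix X :: "'a proset"
  assume "X \<in> obj prosets_fin"
  then have X: "is_proset X"
    by (simp add: prosets_fin_def locally_finite_proset_def)
  have "FCC X X (restrict (\<lambda>x. x) (carrier X))"
    using FCC_id[OF X] by (subst FCC_cong[OF X]) auto
  then show "ident prosets_fin X \<in> hom_set prosets_fin X X"
    by (simp add: prosets_fin_def)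
next
  fix X Y Z :: "'a proset" and f g
  assume XYZ: "X \<in> obj prosets_fin" "Y \<in> obj prosets_fin" "Z \<in> obj prosets_fin"
    and f: "f \<in> hom_set prosets_fin X Y" and g: "g \<in> hom_set prosets_fin Y Z"
  have X: "is_proset X"
    using XYZ by (simp add: prosets_fin_def locally_finite_proset_def)
  have "FCC X Z (g \<circ> f)"
    using XYZ f g by (intro FCC_compose[of X Y]) (auto simp: prosets_fin_def locally_finite_proset_def)
  then have "FCC X Z (compose (carrier X) g f)"
    by (subst FCC_cong[OF X, of _ "g \<circ> f"]) (auto simp: compose_def)
  then show "cat_comp prosets_fin X Y Z g f \<in> hom_set prosets_fin X Z"
    by (simp add: prosets_fin_def)
next
  fix X Y :: "'a proset" and f
  assume "f \<in> hom_set prosets_fin X Y"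
  then have "f \<in> extensional (carrier X)" "f \<in> carrier X \<rightarrow> carrier Y"
    by (simp_all add: prosets_fin_def FCC_funcset)
  then show "cat_comp prosets_fin X X Y f (ident prosets_fin X) = f"
    "cat_comp prosets_fin X Y Y (ident prosets_fin Y) f = f"
    by (simp_all add: prosets_fin_def compose_restrict_id[where B = "carrier Y"])
next
  fix W X Y Z :: "'a proset" and f g h
  assume "f \<in> hom_set prosets_fin W X"
  then have "f \<in> carrier W \<rightarrow> carrier X"
    by (simp add: prosets_fin_def FCC_funcset)
  then show "cat_comp prosets_fin W X Z (cat_comp prosets_fin X Y Z h g) f
      = cat_comp prosets_fin W Y Z h (cat_comp prosets_fin W X Y g f)"
    by (simp add: prosets_fin_def compose_compose)
qed

lemma category_TopRings: "category TopRings"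
proof
  fix X :: "'a top_ring"
  assume "X \<in> obj TopRings"
  then have "topological_ring X"
    by (simp add: TopRings_def)
  then have "ring X" and [simp]: "topspace (topo X) = carrier X"
    by (auto simp: topological_ring_def)
  interpret ring X by fact
  have "restrict (\<lambda>x. x) (carrier X) \<in> ring_hom X X"
    by (auto simp: ring_hom_def)
  moreover have "continuous_map (topo X) (topo X) (restrict (\<lambda>x. x) (carrier X))"
    by (rule continuous_map_eq[OF continuous_map_id]) auto
  ultimately show "ident TopRings X \<in> hom_set TopRings X X"
    by (simp add: TopRings_def)
next
  fix X Y Z :: "'a top_ring" and f g
  assume XYZ: "X \<in> obj TopRings" "Y \<in> obj TopRings" "Z \<in> obj TopRings"
    and f: "f \<in> hom_set TopRings X Y" and g: "g \<in> hom_set TopRings Y Z"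
  have "ring X" and [simp]: "topspace (topo X) = carrier X"
    using XYZ by (auto simp: TopRings_def topological_ring_def)
  interpret ring X by fact
  have fg: "f \<in> ring_hom X Y" "g \<in> ring_hom Y Z"
    "continuous_map (topo X) (topo Y) f" "continuous_map (topo Y) (topo Z) g"
    using f g by (auto simp: TopRings_def)
  have "compose (carrier X) g f \<in> ring_hom X Z"
    using fg(1,2) by (auto simp: ring_hom_def compose_def Pi_iff)
  moreover have "continuous_map (topo X) (topo Z) (compose (carrier X) g f)"
    by (rule continuous_map_eq[OF continuous_map_compose[OF fg(3,4)]]) (simp add: compose_def)
  ultimately show "cat_comp TopRings X Y Z g f \<in> hom_set TopRings X Z"
    by (simp add: TopRings_def)
next
  fix X Y :: "'a top_ring" and f
  assume "f \<in> hom_set TopRings X Y"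
  then have "f \<in> extensional (carrier X)" "f \<in> carrier X \<rightarrow> carrier Y"
    by (simp_all add: TopRings_def ring_hom_def)
  then show "cat_comp TopRings X X Y f (ident TopRings X) = f"
    "cat_comp TopRings X Y Y (ident TopRings Y) f = f"
    by (simp_all add: TopRings_def compose_restrict_id[where B = "carrier Y"])
next
  fix W X Y Z :: "'a top_ring" and f g h
  assume "f \<in> hom_set TopRings W X"
  then have "f \<in> carrier W \<rightarrow> carrier X"
    by (simp add: TopRings_def ring_hom_def)
  then show "cat_comp TopRings W X Z (cat_comp TopRings X Y Z h g) f
      = cat_comp TopRings W Y Z h (cat_comp TopRings W X Y g f)"
    by (simp add: TopRings_def compose_compose)
qed

section \<open>Generalized matrix rings\<close>

text \<open>Serves the associativity of the matrix product. The induction runs over A alone; the sum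
  belonging to a new index is merged into the inner sums by \<open>finsum_addf\<close>.\<close>

lemma (in abelian_monoid) finsum_swap:
  assumes "finite A" "finite B" "\<And>i j. i \<in> A \<Longrightarrow> j \<in> B \<Longrightarrow> h i j \<in> carrier G"
  shows "(\<Oplus>i\<in>A. \<Oplus>j\<in>B. h i j) = (\<Oplus>j\<in>B. \<Oplus>i\<in>A. h i j)"
  using assms(1,3)
proof (induction A rule: finite_induct)
  case empty
  then show ?case by simp
next
  case (insert a A)
  have "(\<Oplus>i\<in>insert a A. \<Oplus>j\<in>B. h i j) = (\<Oplus>j\<in>B. h a j) \<oplus> (\<Oplus>i\<in>A. \<Oplus>j\<in>B. h i j)"
    using insert by (intro finsum_insert) auto
  also have "\<dots> = (\<Oplus>j\<in>B. h a j) \<oplus> (\<Oplus>j\<in>B. \<Oplus>i\<in>A. h i j)"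
    using insert by simp
  also have "\<dots> = (\<Oplus>j\<in>B. h a j \<oplus> (\<Oplus>i\<in>A. h i j))"
    using insert by (intro finsum_addf[symmetric]) auto
  also have "\<dots> = (\<Oplus>j\<in>B. \<Oplus>i\<in>insert a A. h i j)"
    using insert by (intro finsum_cong') auto
  finally show ?case .
qed

section \<open>Continuity of operations in the coefficient ring\<close>

locale coefficient_ring = ring P for P :: "'p top_ring" (structure) +
  assumes topological: "topological_ring P"
begin

lemma topspace_P [simp]: "topspace (topo P) = carrier P"
  using topological by (simp add: topological_ring_def)

lemma continuous_map_carrier:
  "continuous_map X (topo P) f \<Longrightarrow> x \<in> topspace X \<Longrightarrow> f x \<in> carrier P"
  using continuous_map_funspace by fastforce

lemma continuous_map_plus:
  assumes "continuous_map X (topo P) f" "continuous_map X (topo P) g"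
  shows "continuous_map X (topo P) (\<lambda>x. f x \<oplus> g x)"
proof -
  have "continuous_map X (topo P) ((\<lambda>(x, y). x \<oplus> y) \<circ> (\<lambda>x. (f x, g x)))"
    using topological assms
    by (intro continuous_map_compose[of _ "prod_topology (topo P) (topo P)"] continuous_map_pairedI)
      (auto simp: topological_ring_def)
  then show ?thesis
    by (simp add: o_def)
qed

lemma continuous_map_times:
  assumes "continuous_map X (topo P) f" "continuous_map X (topo P) g"
  shows "continuous_map X (topo P) (\<lambda>x. f x \<otimes> g x)"
proof -
  have "continuous_map X (topo P) ((\<lambda>(x, y). x \<otimes> y) \<circ> (\<lambda>x. (f x, g x)))"
    using topological assms
    by (intro continuous_map_compose[of _ "prod_topology (topo P) (topo P)"] continuous_map_pairedI)
      (auto simp: topological_ring_def)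
  then show ?thesis
    by (simp add: o_def)
qed

lemma continuous_map_uminus:
  assumes "continuous_map X (topo P) f"
  shows "continuous_map X (topo P) (\<lambda>x. \<ominus> f x)"
proof -
  have "continuous_map X (topo P) ((\<lambda>x. \<ominus> x) \<circ> f)"
    using topological assms
    by (intro continuous_map_compose[of _ "topo P"]) (auto simp: topological_ring_def)
  then show ?thesis
    by (simp add: o_def)
qed

lemma continuous_map_finsum:
  assumes "finite F" "\<And>i. i \<in> F \<Longrightarrow> continuous_map X (topo P) (g i)"
  shows "continuous_map X (topo P) (\<lambda>x. \<Oplus>i\<in>F. g i x)"
  using assms
proof (induction F rule: finite_induct)
  case empty
  then show ?case by simp
next
  case (insert i F)
  have "continuous_map X (topo P) (\<lambda>x. g i x \<oplus> (\<Oplus>i\<in>F. g i x))"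
    using insert by (intro continuous_map_plus) auto
  then show ?case
  \<comment> \<open>\<open>finsum_insert\<close> needs the summands in the carrier, which is known
    only at points of the space; hence the two functions are compared on
    \<open>topspace X\<close>.\<close>
  proof (rule continuous_map_eq)
    fix x assume "x \<in> topspace X"
    then show "g i x \<oplus> (\<Oplus>i\<in>F. g i x) = (\<Oplus>i\<in>insert i F. g i x)"
      using insert by (intro finsum_insert[symmetric]) (auto intro: continuous_map_carrier)
  qed
qed

end

section \<open>The ring of matrices over a locally finite proset\<close>

locale matrix_ring_setting = coefficient_ring P for P :: "'p top_ring" (structure) +
  fixes L :: "'a proset"
  assumes locally_finite: "locally_finite_proset L"
begin

abbreviation M where "M \<equiv> matrix_ring P L"

lemma proset: "is_proset L"
  using locally_finite by (simp add: locally_finite_proset_def)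

text \<open>Local finiteness speaks only of endpoints with s \<preceq> t; for other endpoints
  transitivity makes the interval empty. The unconditional form spares later sums a case
  distinction.\<close>

lemma finite_interval [simp]: "finite (proset_interval L s t)"
proof (cases "(s, t) \<in> leq L")
  case True
  then show ?thesis
    using locally_finite by (auto simp: locally_finite_proset_def)
next
  case False
  then have "proset_interval L s t = {}"
    using leq_trans[OF proset] by (auto simp: proset_interval_def)
  then show ?thesis by simp
qed

lemma interval_carrier: "u \<in> proset_interval L s t \<Longrightarrow> u \<in> carrier L"
  by (simp add: proset_interval_def)

lemma subinterval:
  assumes "u \<in> proset_interval L s t"
  shows "proset_interval L s u \<subseteq> proset_interval L s t"
    and "proset_interval L u t \<subseteq> proset_interval L s t"
  using assms leq_trans[OF proset, of s u] leq_trans[OF proset, of _ u t]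
  by (auto simp: proset_interval_def)

lemma matrix_iff:
  "A \<in> carrier M \<longleftrightarrow> A \<in> extensional (carrier L \<times> carrier L) \<and>
    (\<forall>s \<in> carrier L. \<forall>t \<in> carrier L. A (s, t) \<in> carrier P \<and> ((s, t) \<notin> leq L \<longrightarrow> A (s, t) = \<zero>))"
proof -
  have "A \<in> carrier M \<longleftrightarrow> A \<in> carrier L \<times> carrier L \<rightarrow>\<^sub>E carrier P \<and>
      (\<forall>s \<in> carrier L. \<forall>t \<in> carrier L. A (s, t) \<noteq> \<zero> \<longrightarrow> (s, t) \<in> leq L)"
    by (simp add: matrix_ring_def matrix_carrier_def)
  also have "A \<in> carrier L \<times> carrier L \<rightarrow>\<^sub>E carrier P \<longleftrightarrow> A \<in> extensional (carrier L \<times> carrier L) \<and>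
      (\<forall>s \<in> carrier L. \<forall>t \<in> carrier L. A (s, t) \<in> carrier P)"
    unfolding PiE_iff by blast
  finally show ?thesis by blast
qed

lemma entry_closed [simp]:
  "A \<in> carrier M \<Longrightarrow> s \<in> carrier L \<Longrightarrow> t \<in> carrier L \<Longrightarrow> A (s, t) \<in> carrier P"
  by (simp add: matrix_iff)

lemma entry_zero:
  "A \<in> carrier M \<Longrightarrow> s \<in> carrier L \<Longrightarrow> t \<in> carrier L \<Longrightarrow> (s, t) \<notin> leq L \<Longrightarrow> A (s, t) = \<zero>"
  by (simp add: matrix_iff)

lemma matrixI:
  assumes "\<And>s t. s \<in> carrier L \<Longrightarrow> t \<in> carrier L \<Longrightarrow> A (s, t) \<in> carrier P"
    and "\<And>s t. s \<in> carrier L \<Longrightarrow> t \<in> carrier L \<Longrightarrow> (s, t) \<notin> leq L \<Longrightarrow> A (s, t) = \<zero>"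
    and "A \<in> extensional (carrier L \<times> carrier L)"
  shows "A \<in> carrier M"
  using assms by (simp add: matrix_iff)

lemma matrix_eqI:
  assumes "A \<in> carrier M" "B \<in> carrier M"
    and "\<And>s t. s \<in> carrier L \<Longrightarrow> t \<in> carrier L \<Longrightarrow> A (s, t) = B (s, t)"
  shows "A = B"
proof (rule extensionalityI)
  show "A \<in> extensional (carrier L \<times> carrier L)" "B \<in> extensional (carrier L \<times> carrier L)"
    using assms(1,2) by (simp_all only: matrix_iff)
  fix x assume "x \<in> carrier L \<times> carrier L"
  then show "A x = B x"
    using assms(3) by (cases x) simp
qed

lemma add_entry [simp]:
  "s \<in> carrier L \<Longrightarrow> t \<in> carrier L \<Longrightarrow> (A \<oplus>\<^bsub>M\<^esub> B) (s, t) = A (s, t) \<oplus> B (s, t)"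
  by (simp add: matrix_ring_def)

lemma zero_entry [simp]: "s \<in> carrier L \<Longrightarrow> t \<in> carrier L \<Longrightarrow> \<zero>\<^bsub>M\<^esub> (s, t) = \<zero>"
  by (simp add: matrix_ring_def)

lemma one_entry:
  "s \<in> carrier L \<Longrightarrow> t \<in> carrier L \<Longrightarrow> \<one>\<^bsub>M\<^esub> (s, t) = (if s = t then \<one> else \<zero>)"
  by (simp add: matrix_ring_def)

lemma mult_entry:
  "s \<in> carrier L \<Longrightarrow> t \<in> carrier L \<Longrightarrow>
    (A \<otimes>\<^bsub>M\<^esub> B) (s, t) = (\<Oplus>u \<in> proset_interval L s t. A (s, u) \<otimes> B (u, t))"
  by (simp add: matrix_ring_def)

text \<open>For u outside the interval one of the positions (s, u), (u, t) is not in the order, so a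
  factor vanishes. Enlarging the index set makes it possible to sum several products over one common
  set.\<close>

lemma mult_entry_superset:
  assumes "A \<in> carrier M" "B \<in> carrier M" "s \<in> carrier L" "t \<in> carrier L"
    and "finite F" "proset_interval L s t \<subseteq> F" "F \<subseteq> carrier L"
  shows "(A \<otimes>\<^bsub>M\<^esub> B) (s, t) = (\<Oplus>u \<in> F. A (s, u) \<otimes> B (u, t))"
  unfolding mult_entry[OF assms(3,4)]
proof (rule add.finprod_mono_neutral_cong_left[OF assms(5,6)])
  fix u assume "u \<in> F - proset_interval L s t"
  then have "u \<in> carrier L" "(s, u) \<notin> leq L \<or> (u, t) \<notin> leq L"
    using assms(7) by (auto simp: proset_interval_def)
  then show "A (s, u) \<otimes> B (u, t) = \<zero>"
    using assms(1-4) by (auto simp: entry_zero)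
qed (use assms in auto)

lemma add_closed: "A \<in> carrier M \<Longrightarrow> B \<in> carrier M \<Longrightarrow> A \<oplus>\<^bsub>M\<^esub> B \<in> carrier M"
  by (rule matrixI) (auto simp: entry_zero, auto simp: matrix_ring_def)

lemma zero_closed_matrix: "\<zero>\<^bsub>M\<^esub> \<in> carrier M"
  by (rule matrixI) (auto, auto simp: matrix_ring_def)

lemma one_closed_matrix: "\<one>\<^bsub>M\<^esub> \<in> carrier M"
  using leq_refl[OF proset] by (intro matrixI) (auto simp: one_entry, auto simp: matrix_ring_def)

lemma mult_closed:
  assumes "A \<in> carrier M" "B \<in> carrier M"
  shows "A \<otimes>\<^bsub>M\<^esub> B \<in> carrier M"
proof (rule matrixI)
  fix s t assume st: "s \<in> carrier L" "t \<in> carrier L"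
  show "(A \<otimes>\<^bsub>M\<^esub> B) (s, t) \<in> carrier P"
    using st assms by (auto simp: mult_entry interval_carrier intro!: finsum_closed)
  assume "(s, t) \<notin> leq L"
  then have "proset_interval L s t = {}"
    using leq_trans[OF proset] by (auto simp: proset_interval_def)
  then show "(A \<otimes>\<^bsub>M\<^esub> B) (s, t) = \<zero>"
    using st by (simp add: mult_entry)
qed (simp add: matrix_ring_def)

text \<open>The inner sums run over [s, u] or [v, t], which depend on the outer index. Both are
  enlarged to [s, t]; then the two bracketings are one double sum over the square of [s, t], read in
  two orders.\<close>

lemma mult_assoc:
  assumes A: "A \<in> carrier M" and B: "B \<in> carrier M" and C: "C \<in> carrier M"
  shows "(A \<otimes>\<^bsub>M\<^esub> B) \<otimes>\<^bsub>M\<^esub> C = A \<otimes>\<^bsub>M\<^esub> (B \<otimes>\<^bsub>M\<^esub> C)"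
proof (rule matrix_eqI)
  fix s t assume st: "s \<in> carrier L" "t \<in> carrier L"
  let ?I = "proset_interval L s t"
  have car: "u \<in> carrier L" if "u \<in> ?I" for u
    using that by (rule interval_carrier)
  have left: "(A \<otimes>\<^bsub>M\<^esub> B) (s, u) = (\<Oplus>v\<in>?I. A (s, v) \<otimes> B (v, u))" if "u \<in> ?I" for u
    using st A B car that by (intro mult_entry_superset subinterval) auto
  have right: "(B \<otimes>\<^bsub>M\<^esub> C) (v, t) = (\<Oplus>u\<in>?I. B (v, u) \<otimes> C (u, t))" if "v \<in> ?I" for v
    using st B C car that by (intro mult_entry_superset subinterval) auto
  have "((A \<otimes>\<^bsub>M\<^esub> B) \<otimes>\<^bsub>M\<^esub> C) (s, t) = (\<Oplus>u\<in>?I. (A \<otimes>\<^bsub>M\<^esub> B) (s, u) \<otimes> C (u, t))"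
    by (rule mult_entry[OF st])
  also have "\<dots> = (\<Oplus>u\<in>?I. \<Oplus>v\<in>?I. A (s, v) \<otimes> B (v, u) \<otimes> C (u, t))"
    using A B C st car by (intro finsum_cong') (auto simp: left finsum_ldistr)
  also have "\<dots> = (\<Oplus>v\<in>?I. \<Oplus>u\<in>?I. A (s, v) \<otimes> B (v, u) \<otimes> C (u, t))"
    using A B C st car by (intro finsum_swap) auto
  also have "\<dots> = (\<Oplus>v\<in>?I. \<Oplus>u\<in>?I. A (s, v) \<otimes> (B (v, u) \<otimes> C (u, t)))"
    using A B C st car by (intro finsum_cong') (auto simp: m_assoc intro!: finsum_cong')
  also have "\<dots> = (\<Oplus>v\<in>?I. A (s, v) \<otimes> (B \<otimes>\<^bsub>M\<^esub> C) (v, t))"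
    using A B C st car by (intro finsum_cong') (auto simp: right finsum_rdistr)
  also have "\<dots> = (A \<otimes>\<^bsub>M\<^esub> (B \<otimes>\<^bsub>M\<^esub> C)) (s, t)"
    by (rule mult_entry[OF st, symmetric])
  finally show "((A \<otimes>\<^bsub>M\<^esub> B) \<otimes>\<^bsub>M\<^esub> C) (s, t) = (A \<otimes>\<^bsub>M\<^esub> (B \<otimes>\<^bsub>M\<^esub> C)) (s, t)" .
qed (intro mult_closed A B C)+

lemma mult_one_right:
  assumes A: "A \<in> carrier M"
  shows "A \<otimes>\<^bsub>M\<^esub> \<one>\<^bsub>M\<^esub> = A"
proof (rule matrix_eqI)
  fix s t assume st: "s \<in> carrier L" "t \<in> carrier L"
  \<comment> \<open>If s \<preceq> t fails, the interval is empty and misses t. With t added, the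
    one term that survives, u = t, is present in every case and equals A (s, t).\<close>
  let ?F = "insert t (proset_interval L s t)"
  have F: "?F \<subseteq> carrier L"
    using st by (auto simp: interval_carrier)
  then have "(A \<otimes>\<^bsub>M\<^esub> \<one>\<^bsub>M\<^esub>) (s, t) = (\<Oplus>u\<in>?F. A (s, u) \<otimes> \<one>\<^bsub>M\<^esub> (u, t))"
    using A st one_closed_matrix by (intro mult_entry_superset) auto
  also have "\<dots> = (\<Oplus>u\<in>?F. if u = t then A (s, u) else \<zero>)"
    using A st F by (intro finsum_cong') (auto simp: one_entry)
  also have "\<dots> = A (s, t)"
    using A st F by (intro add.finprod_singleton_swap) auto
  finally show "(A \<otimes>\<^bsub>M\<^esub> \<one>\<^bsub>M\<^esub>) (s, t) = A (s, t)" .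
qed (intro mult_closed A one_closed_matrix)+

lemma mult_one_left:
  assumes A: "A \<in> carrier M"
  shows "\<one>\<^bsub>M\<^esub> \<otimes>\<^bsub>M\<^esub> A = A"
proof (rule matrix_eqI)
  fix s t assume st: "s \<in> carrier L" "t \<in> carrier L"
  let ?F = "insert s (proset_interval L s t)"
  have F: "?F \<subseteq> carrier L"
    using st by (auto simp: interval_carrier)
  then have "(\<one>\<^bsub>M\<^esub> \<otimes>\<^bsub>M\<^esub> A) (s, t) = (\<Oplus>u\<in>?F. \<one>\<^bsub>M\<^esub> (s, u) \<otimes> A (u, t))"
    using A st one_closed_matrix by (intro mult_entry_superset) auto
  also have "\<dots> = (\<Oplus>u\<in>?F. if s = u then A (u, t) else \<zero>)"
    using A st F by (intro finsum_cong') (auto simp: one_entry)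
  also have "\<dots> = A (s, t)"
    using A st F by (intro add.finprod_singleton) auto
  finally show "(\<one>\<^bsub>M\<^esub> \<otimes>\<^bsub>M\<^esub> A) (s, t) = A (s, t)" .
qed (intro mult_closed A one_closed_matrix)+

text \<open>The record has no field for negation: \<open>a_inv\<close> is a definite description in
  terms of the addition. This explicit entrywise negative supplies the inverses for the group axioms
  and, once identified with \<open>a_inv\<close>, makes continuity of negation an entrywise
  matter.\<close>

definition neg :: "('a \<times> 'a \<Rightarrow> 'p) \<Rightarrow> ('a \<times> 'a \<Rightarrow> 'p)" where
  "neg A = restrict (\<lambda>x. \<ominus> A x) (carrier L \<times> carrier L)"

lemma neg_closed: "A \<in> carrier M \<Longrightarrow> neg A \<in> carrier M"
  by (rule matrixI) (auto simp: neg_def entry_zero)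

lemma neg_add: "A \<in> carrier M \<Longrightarrow> neg A \<oplus>\<^bsub>M\<^esub> A = \<zero>\<^bsub>M\<^esub>"
  by (rule matrix_eqI)
    (auto simp: neg_def l_neg intro: add_closed zero_closed_matrix neg_closed[unfolded neg_def])

lemma mult_distrib_right:
  assumes A: "A \<in> carrier M" and B: "B \<in> carrier M" and C: "C \<in> carrier M"
  shows "(A \<oplus>\<^bsub>M\<^esub> B) \<otimes>\<^bsub>M\<^esub> C = A \<otimes>\<^bsub>M\<^esub> C \<oplus>\<^bsub>M\<^esub> B \<otimes>\<^bsub>M\<^esub> C"
proof (rule matrix_eqI)
  fix s t assume st: "s \<in> carrier L" "t \<in> carrier L"
  have "((A \<oplus>\<^bsub>M\<^esub> B) \<otimes>\<^bsub>M\<^esub> C) (s, t) =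
      (\<Oplus>u\<in>proset_interval L s t. A (s, u) \<otimes> C (u, t) \<oplus> B (s, u) \<otimes> C (u, t))"
    unfolding mult_entry[OF st] using A B C st
    by (intro finsum_cong') (auto simp: interval_carrier l_distr)
  also have "\<dots> = (A \<otimes>\<^bsub>M\<^esub> C \<oplus>\<^bsub>M\<^esub> B \<otimes>\<^bsub>M\<^esub> C) (s, t)"
    unfolding add_entry[OF st] mult_entry[OF st] using A B C st
    by (intro finsum_addf) (auto simp: interval_carrier)
  finally show "((A \<oplus>\<^bsub>M\<^esub> B) \<otimes>\<^bsub>M\<^esub> C) (s, t) = (A \<otimes>\<^bsub>M\<^esub> C \<oplus>\<^bsub>M\<^esub> B \<otimes>\<^bsub>M\<^esub> C) (s, t)" .
qed (intro mult_closed add_closed A B C)+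

lemma mult_distrib_left:
  assumes A: "A \<in> carrier M" and B: "B \<in> carrier M" and C: "C \<in> carrier M"
  shows "C \<otimes>\<^bsub>M\<^esub> (A \<oplus>\<^bsub>M\<^esub> B) = C \<otimes>\<^bsub>M\<^esub> A \<oplus>\<^bsub>M\<^esub> C \<otimes>\<^bsub>M\<^esub> B"
proof (rule matrix_eqI)
  fix s t assume st: "s \<in> carrier L" "t \<in> carrier L"
  have "(C \<otimes>\<^bsub>M\<^esub> (A \<oplus>\<^bsub>M\<^esub> B)) (s, t) =
      (\<Oplus>u\<in>proset_interval L s t. C (s, u) \<otimes> A (u, t) \<oplus> C (s, u) \<otimes> B (u, t))"
    unfolding mult_entry[OF st] using A B C st
    by (intro finsum_cong') (auto simp: interval_carrier r_distr)
  also have "\<dots> = (C \<otimes>\<^bsub>M\<^esub> A \<oplus>\<^bsub>M\<^esub> C \<otimes>\<^bsub>M\<^esub> B) (s, t)"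
    unfolding add_entry[OF st] mult_entry[OF st] using A B C st
    by (intro finsum_addf) (auto simp: interval_carrier)
  finally show "(C \<otimes>\<^bsub>M\<^esub> (A \<oplus>\<^bsub>M\<^esub> B)) (s, t) = (C \<otimes>\<^bsub>M\<^esub> A \<oplus>\<^bsub>M\<^esub> C \<otimes>\<^bsub>M\<^esub> B) (s, t)" .
qed (intro mult_closed add_closed A B C)+

lemma ring_matrix: "ring M"
proof (rule ringI)
  show "abelian_group M"
  proof (rule abelian_groupI)
    fix A B C assume "A \<in> carrier M" "B \<in> carrier M" "C \<in> carrier M"
    then show "A \<oplus>\<^bsub>M\<^esub> B \<oplus>\<^bsub>M\<^esub> C = A \<oplus>\<^bsub>M\<^esub> (B \<oplus>\<^bsub>M\<^esub> C)"
      by (intro matrix_eqI add_closed) (simp_all add: a_assoc)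
  next
    fix A B assume "A \<in> carrier M" "B \<in> carrier M"
    then show "A \<oplus>\<^bsub>M\<^esub> B = B \<oplus>\<^bsub>M\<^esub> A"
      by (intro matrix_eqI add_closed) (simp_all add: a_comm)
  next
    fix A assume "A \<in> carrier M"
    then show "\<zero>\<^bsub>M\<^esub> \<oplus>\<^bsub>M\<^esub> A = A"
      by (intro matrix_eqI add_closed zero_closed_matrix) simp_all
  qed (use add_closed zero_closed_matrix neg_closed neg_add in blast)+
  show "monoid M"
    by (rule monoidI) (simp_all add: mult_closed one_closed_matrix mult_assoc mult_one_left mult_one_right)
qed (simp_all add: mult_distrib_left mult_distrib_right)

lemma minus_eq_neg: "A \<in> carrier M \<Longrightarrow> \<ominus>\<^bsub>M\<^esub> A = neg A"
proof -
  interpret R: ring M by (rule ring_matrix)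
  show "A \<in> carrier M \<Longrightarrow> \<ominus>\<^bsub>M\<^esub> A = neg A"
    using neg_add neg_closed by (intro R.minus_equality) auto
qed

section \<open>The topology of the matrix ring\<close>

lemma topspace_matrix [simp]: "topspace (topo M) = carrier M"
proof -
  have "carrier M \<subseteq> carrier L \<times> carrier L \<rightarrow>\<^sub>E carrier P"
    unfolding matrix_ring_def matrix_carrier_def by simp
  then show ?thesis
    by (simp add: matrix_ring_def Int_absorb1)
qed

lemma continuous_entry:
  assumes "s \<in> carrier L" "t \<in> carrier L"
  shows "continuous_map (topo M) (topo P) (\<lambda>A. A (s, t))"
proof -
  have "continuous_map (product_topology (\<lambda>_. topo P) (carrier L \<times> carrier L)) (topo P)
      (\<lambda>A. A (s, t))"
    using assms by (intro continuous_map_product_projection[where X = "\<lambda>_. topo P"]) simp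
  then show ?thesis
    by (simp add: matrix_ring_def continuous_map_from_subtopology)
qed

text \<open>This is the universal property of a subspace of a product. It turns continuity claims
  about matrices into claims about functions with values in P.\<close>

lemma continuous_map_into_matrix:
  assumes "\<And>x. x \<in> topspace X \<Longrightarrow> h x \<in> carrier M"
    and "\<And>s t. s \<in> carrier L \<Longrightarrow> t \<in> carrier L \<Longrightarrow> continuous_map X (topo P) (\<lambda>x. h x (s, t))"
  shows "continuous_map X (topo M) h"
proof -
  have "continuous_map X (product_topology (\<lambda>_. topo P) (carrier L \<times> carrier L)) h"
    unfolding continuous_map_componentwise
  proof (intro conjI ballI)
    show "h ` topspace X \<subseteq> extensional (carrier L \<times> carrier L)"
      using assms(1) by (simp add: matrix_iff image_subset_iff)
    fix x assume "x \<in> carrier L \<times> carrier L"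
    then show "continuous_map X (topo P) (\<lambda>y. h y x)"
      using assms(2) by (cases x) simp
  qed
  moreover have "h \<in> topspace X \<rightarrow> matrix_carrier L P"
    using assms(1) by (simp add: matrix_ring_def)
  ultimately show ?thesis
    by (simp add: matrix_ring_def continuous_map_in_subtopology)
qed

lemma Hausdorff_matrix: "Hausdorff_space (topo M)"
proof -
  have "Hausdorff_space (topo P)"
    using topological by (simp add: topological_ring_def)
  then show ?thesis
    by (simp add: matrix_ring_def Hausdorff_space_subtopology Hausdorff_space_product_topology)
qed

lemma topological_ring_matrix: "topological_ring M"
proof -
  have fst: "continuous_map (prod_topology (topo M) (topo M)) (topo P) (\<lambda>x. fst x (s, t))"
    and snd: "continuous_map (prod_topology (topo M) (topo M)) (topo P) (\<lambda>x. snd x (s, t))"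
    if "s \<in> carrier L" "t \<in> carrier L" for s t
    using continuous_map_compose[OF continuous_map_fst continuous_entry[OF that], of "topo M"]
      continuous_map_compose[OF continuous_map_snd continuous_entry[OF that], of "topo M"]
    by (simp_all add: o_def)
  have "continuous_map (prod_topology (topo M) (topo M)) (topo M) (\<lambda>(A, B). A \<oplus>\<^bsub>M\<^esub> B)"
    by (rule continuous_map_into_matrix)
      (auto simp: case_prod_unfold add_closed intro!: continuous_map_plus fst snd)
  \<comment> \<open>Local finiteness is what gives continuity of multiplication: each entry of a
    product is a finite sum of products of entries, and so involves only finitely many
    coordinates.\<close>
  moreover have "continuous_map (prod_topology (topo M) (topo M)) (topo M) (\<lambda>(A, B). A \<otimes>\<^bsub>M\<^esub> B)"
    by (rule continuous_map_into_matrix)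
      (auto simp: case_prod_unfold mult_closed mult_entry interval_carrier
        intro!: continuous_map_finsum continuous_map_times fst snd)
  moreover have "continuous_map (topo M) (topo M) neg"
    by (rule continuous_map_into_matrix)
      (auto simp: neg_closed, auto simp: neg_def intro!: continuous_map_uminus continuous_entry)
  then have "continuous_map (topo M) (topo M) (\<lambda>A. \<ominus>\<^bsub>M\<^esub> A)"
    by (rule continuous_map_eq) (simp add: minus_eq_neg)
  ultimately show ?thesis
    using ring_matrix Hausdorff_matrix by (simp add: topological_ring_def)
qed

end


section \<open>Induced maps of matrix rings\<close>

text \<open>The prefixes \<open>dom\<close> and \<open>cod\<close> refer to f : L1 -> L2. By
  contravariance \<open>matrix_map\<close> goes the other way, from \<open>cod.M\<close> to
  \<open>dom.M\<close>.\<close>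

locale induced_map =
  dom: matrix_ring_setting P L1 + cod: matrix_ring_setting P L2
  for P :: "'p top_ring" (structure) and L1 :: "'a proset" and L2 :: "'b proset" +
  fixes f :: "'a \<Rightarrow> 'b"
  assumes FCC: "FCC L1 L2 f"
begin

abbreviation Mf where "Mf \<equiv> matrix_map P L1 L2 f"

lemma f_carrier [simp]: "t \<in> carrier L1 \<Longrightarrow> f t \<in> carrier L2"
  using FCC_funcset[OF FCC] by auto

lemma f_leq: "(s, t) \<in> leq L1 \<Longrightarrow> (f s, f t) \<in> leq L2"
  using FCC_order_preserving[OF dom.proset FCC] by (auto simp: order_preserving_def)

text \<open>On the diagonal f s = f t, so the first two clauses of \<open>matrix_map\<close> both
  read A at (f s, f t) and merge into one condition.\<close>

lemma map_entry:
  assumes "A \<in> carrier cod.M" "s \<in> carrier L1" "t \<in> carrier L1"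
  shows "Mf A (s, t) = (if s = t \<or> (s, t) \<in> leq L1 \<and> f s \<noteq> f t then A (f s, f t) else \<zero>)"
  using assms by (auto simp: matrix_map_apply)

lemma map_closed:
  assumes "A \<in> carrier cod.M"
  shows "Mf A \<in> carrier dom.M"
proof (rule dom.matrixI)
  show "Mf A \<in> extensional (carrier L1 \<times> carrier L1)"
    using assms by (simp add: matrix_map_apply)
qed (use assms leq_refl[OF dom.proset] in \<open>auto simp: map_entry\<close>)

lemma map_mult:
  assumes A: "A \<in> carrier cod.M" and B: "B \<in> carrier cod.M"
  shows "Mf (A \<otimes>\<^bsub>cod.M\<^esub> B) = Mf A \<otimes>\<^bsub>dom.M\<^esub> Mf B"
proof (rule dom.matrix_eqI)
  fix s t assume st: "s \<in> carrier L1" "t \<in> carrier L1"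
  let ?I = "proset_interval L1 s t"
  have AB: "A \<otimes>\<^bsub>cod.M\<^esub> B \<in> carrier cod.M"
    using A B by (rule cod.mult_closed)
  have car: "u \<in> carrier L1" if "u \<in> ?I" for u
    using that by (rule dom.interval_carrier)
  have closed: "A (f s, f u) \<otimes> B (f u, f t) \<in> carrier P" if "u \<in> ?I" for u
    using A B st car[OF that] by simp
  show "Mf (A \<otimes>\<^bsub>cod.M\<^esub> B) (s, t) = (Mf A \<otimes>\<^bsub>dom.M\<^esub> Mf B) (s, t)"
  proof (cases "(s, t) \<in> leq L1")
    case False
    then show ?thesis
      using dom.entry_zero[OF map_closed[OF AB] st]
        dom.entry_zero[OF dom.mult_closed[OF map_closed[OF A] map_closed[OF B]] st]
      by simp
  next
    case True
    have mem: "s \<in> ?I" "t \<in> ?I"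
      using st True leq_refl[OF dom.proset] by (auto simp: proset_interval_def)
    \<comment> \<open>For u in [s, t] both (s, u) and (u, t) lie in the order, so the only remaining
      reason to set an entry to 0 is that two distinct points have the same image.\<close>
    have entries: "Mf A (s, u) = (if s = u \<or> f s \<noteq> f u then A (f s, f u) else \<zero>)"
      "Mf B (u, t) = (if u = t \<or> f u \<noteq> f t then B (f u, f t) else \<zero>)" if "u \<in> ?I" for u
      using A B st car[OF that] that by (auto simp: map_entry proset_interval_def)
    note image = FCC_interval(1)[OF dom.proset FCC True]
    \<comment> \<open>Since f maps [s, t] onto [f s, f t], the product entry upstairs becomes a sum
      over an image under f. Injectivity reindexes it by [s, t]; constancy reduces it to one
      term.\<close>
    have f_image: "(A \<otimes>\<^bsub>cod.M\<^esub> B) (f s, f t) = (\<Oplus>u\<in>f ` ?I. A (f s, u) \<otimes> B (u, f t))"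
      unfolding image using st by (simp add: cod.mult_entry)
    from FCC_interval(2)[OF dom.proset FCC True] show ?thesis
    proof
      assume inj: "inj_on f ?I"
      \<comment> \<open>The endpoints lie in [s, t], so by injectivity s = t or f s \<noteq> f t,
        and the entry is not set to 0.\<close>
      have "Mf (A \<otimes>\<^bsub>cod.M\<^esub> B) (s, t) = (A \<otimes>\<^bsub>cod.M\<^esub> B) (f s, f t)"
        using inj mem True st AB by (auto simp: map_entry inj_on_def)
      also have "\<dots> = (\<Oplus>u\<in>?I. A (f s, f u) \<otimes> B (f u, f t))"
        unfolding f_image using closed inj by (intro dom.add.finprod_reindex) auto
      also have "\<dots> = (\<Oplus>u\<in>?I. Mf A (s, u) \<otimes> Mf B (u, t))"
      proof (rule dom.finsum_cong'[symmetric])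
        fix u assume u: "u \<in> ?I"
        have "s = u \<or> f s \<noteq> f u" "u = t \<or> f u \<noteq> f t"
          using inj mem u by (auto simp: inj_on_def)
        then show "Mf A (s, u) \<otimes> Mf B (u, t) = A (f s, f u) \<otimes> B (f u, f t)"
          using u by (simp add: entries)
      qed (use closed in auto)
      also have "\<dots> = (Mf A \<otimes>\<^bsub>dom.M\<^esub> Mf B) (s, t)"
        using st by (simp add: dom.mult_entry)
      finally show ?thesis .
    next
      assume const: "\<forall>u\<in>?I. f u = f s"
      define c where "c = f s"
      have fc: "f u = c" if "u \<in> ?I" for u
        using const that unfolding c_def by blast
      have c: "c \<in> carrier L2"
        using st by (simp add: c_def)
      have entries_c: "Mf A (s, u) = (if s = u then A (c, c) else \<zero>)"
        "Mf B (u, t) = (if u = t then B (c, c) else \<zero>)" if "u \<in> ?I" for u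
        using entries[OF that] fc[OF that] fc[OF mem(1)] fc[OF mem(2)] by simp_all
      have "(Mf A \<otimes>\<^bsub>dom.M\<^esub> Mf B) (s, t) = (\<Oplus>u\<in>?I. Mf A (s, u) \<otimes> Mf B (u, t))"
        using st by (simp add: dom.mult_entry)
      \<comment> \<open>The factor from A survives only at u = s and the factor from B only at u =
        t. Hence at most the term u = s remains, and only if s = t.\<close>
      also have "\<dots> = (\<Oplus>u\<in>?I. if u = s then (if s = t then A (c, c) \<otimes> B (c, c) else \<zero>) else \<zero>)"
        using A B c by (intro dom.finsum_cong') (auto simp: entries_c)
      also have "\<dots> = (if s = t then A (c, c) \<otimes> B (c, c) else \<zero>)"
        using A B c mem(1) by (intro dom.add.finprod_singleton_swap) auto
      also have "\<dots> = Mf (A \<otimes>\<^bsub>cod.M\<^esub> B) (s, t)"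
      proof (cases "s = t")
        case eq: True
        \<comment> \<open>Even for s = t the interval [s, s] can contain further points, equivalent
          to s. All of them have image c, so the sum in \<open>f_image\<close>, taken over images,
          has a single term.\<close>
        have "f ` ?I = {c}"
          using fc mem(1) by (auto simp: image_iff intro!: bexI[of _ s])
        then have "(A \<otimes>\<^bsub>cod.M\<^esub> B) (c, c) = A (c, c) \<otimes> B (c, c)"
          using f_image A B c by (simp add: fc[OF mem(1)] fc[OF mem(2)])
        moreover have "Mf (A \<otimes>\<^bsub>cod.M\<^esub> B) (s, t) = (A \<otimes>\<^bsub>cod.M\<^esub> B) (c, c)"
          unfolding map_entry[OF AB st] fc[OF mem(1)] fc[OF mem(2)] using eq by simp
        ultimately show ?thesis
          using eq by simp
      next
        case False
        then show ?thesis
          by (simp add: map_entry[OF AB st] fc[OF mem(1)] fc[OF mem(2)])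
      qed
      finally show ?thesis by simp
    qed
  qed
qed (intro map_closed cod.mult_closed dom.mult_closed A B)+

lemma map_extensional: "Mf \<in> extensional (carrier cod.M)"
  by (simp add: matrix_map_def)

lemma map_ring_hom: "Mf \<in> ring_hom cod.M dom.M"
proof (rule ring_hom_memI)
  fix A B assume A: "A \<in> carrier cod.M" and B: "B \<in> carrier cod.M"
  show "Mf (A \<oplus>\<^bsub>cod.M\<^esub> B) = Mf A \<oplus>\<^bsub>dom.M\<^esub> Mf B"
    using A B by (intro dom.matrix_eqI dom.add_closed map_closed cod.add_closed)
      (auto simp: map_entry cod.add_closed)
next
  \<comment> \<open>The clause f s \<noteq> f t of \<open>matrix_map\<close> is essential here:
    without it, distinct comparable points with one image would receive the entry 1 off the
    diagonal.\<close>
  show "Mf \<one>\<^bsub>cod.M\<^esub> = \<one>\<^bsub>dom.M\<^esub>"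
    by (intro dom.matrix_eqI map_closed cod.one_closed_matrix dom.one_closed_matrix)
      (auto simp: map_entry dom.one_entry cod.one_entry cod.one_closed_matrix)
qed (simp_all add: map_closed map_mult)

lemma map_continuous: "continuous_map (topo cod.M) (topo dom.M) Mf"
proof (rule dom.continuous_map_into_matrix)
  fix s t assume st: "s \<in> carrier L1" "t \<in> carrier L1"
  \<comment> \<open>The condition does not depend on A, so each entry is either a coordinate
    projection or constantly 0.\<close>
  have "continuous_map (topo cod.M) (topo P)
      (\<lambda>A. if s = t \<or> (s, t) \<in> leq L1 \<and> f s \<noteq> f t then A (f s, f t) else \<zero>)"
    using st by (auto intro: cod.continuous_entry)
  then show "continuous_map (topo cod.M) (topo P) (\<lambda>A. Mf A (s, t))"
    by (rule continuous_map_eq) (use st in \<open>simp add: map_entry\<close>)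
qed (simp add: map_closed)

end

section \<open>Functoriality\<close>

theorem theorem4p2:
  fixes P :: "'p top_ring"
  assumes "topological_ring P"
  shows "contravariant_functor (prosets_fin :: ('a proset, 'a \<Rightarrow> 'a) cat)
           (TopRings :: (('a \<times> 'a \<Rightarrow> 'p) top_ring, ('a \<times> 'a \<Rightarrow> 'p) \<Rightarrow> ('a \<times> 'a \<Rightarrow> 'p)) cat)
           (matrix_ring P) (matrix_map P)"
proof -
  have setting: "matrix_ring_setting P X" if "X \<in> obj prosets_fin" for X :: "'a proset"
    using assms that
    by (simp add: matrix_ring_setting_def coefficient_ring_def coefficient_ring_axioms_def
        matrix_ring_setting_axioms_def topological_ring_def prosets_fin_def)
  have induced: "induced_map P X Y f"
    if "X \<in> obj prosets_fin" "Y \<in> obj prosets_fin" "f \<in> hom_set prosets_fin X Y"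
    for X Y :: "'a proset" and f
    using setting[OF that(1)] setting[OF that(2)] that(3)
    by (simp add: induced_map_def induced_map_axioms_def prosets_fin_def)
  interpret C: category "prosets_fin :: ('a proset, 'a \<Rightarrow> 'a) cat"
    by (rule category_prosets_fin)
  show ?thesis
  proof (intro contravariant_functor.intro category_prosets_fin category_TopRings
      contravariant_functor_axioms.intro)
    fix X :: "'a proset" assume X: "X \<in> obj prosets_fin"
    interpret X: matrix_ring_setting P X by (rule setting[OF X])
    show "matrix_ring P X \<in> obj TopRings"
      using X.topological_ring_matrix by (simp add: TopRings_def)
    interpret id: induced_map P X X "ident prosets_fin X"
      by (intro induced X C.ident_in_hom)
    have id: "ident prosets_fin X t = t" if "t \<in> carrier X" for t
      using that by (simp add: prosets_fin_def)
    have "matrix_map P X X (ident prosets_fin X) A = A" if A: "A \<in> carrier X.M" for A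
    proof (rule X.matrix_eqI)
      fix s t assume st: "s \<in> carrier X" "t \<in> carrier X"
      \<comment> \<open>Distinct points keep distinct images, so only entries outside the order are
        set to 0, and there A vanishes already.\<close>
      show "matrix_map P X X (ident prosets_fin X) A (s, t) = A (s, t)"
        using X.entry_zero[OF A st] by (auto simp: id.map_entry[OF A st] id st)
    qed (intro id.map_closed A)+
    then show "matrix_map P X X (ident prosets_fin X) = ident TopRings (matrix_ring P X)"
      by (intro extensionalityI[OF id.map_extensional]) (simp_all add: TopRings_def)
  next
    fix X Y :: "'a proset" and f
    assume "X \<in> obj prosets_fin" "Y \<in> obj prosets_fin" "f \<in> hom_set prosets_fin X Y"
    then interpret induced_map P X Y f by (rule induced)
    show "matrix_map P X Y f \<in> hom_set TopRings (matrix_ring P Y) (matrix_ring P X)"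
      using map_ring_hom map_continuous by (simp add: TopRings_def map_extensional)
  next
    fix X Y Z :: "'a proset" and f g
    assume X: "X \<in> obj prosets_fin" and Y: "Y \<in> obj prosets_fin" and Z: "Z \<in> obj prosets_fin"
      and f: "f \<in> hom_set prosets_fin X Y" and g: "g \<in> hom_set prosets_fin Y Z"
    let ?gf = "cat_comp prosets_fin X Y Z g f"
    interpret f: induced_map P X Y f by (rule induced[OF X Y f])
    interpret g: induced_map P Y Z g by (rule induced[OF Y Z g])
    interpret gf: induced_map P X Z ?gf by (intro induced X Z C.comp_in_hom[OF X Y Z f g])
    have gf: "?gf t = g (f t)" if "t \<in> carrier X" for t
      using that by (simp add: prosets_fin_def compose_def)
    have "matrix_map P X Z ?gf A = matrix_map P X Y f (matrix_map P Y Z g A)"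
      if A: "A \<in> carrier (matrix_ring P Z)" for A
    proof (rule f.dom.matrix_eqI)
      fix s t assume st: "s \<in> carrier X" "t \<in> carrier X"
      then have fst: "f s \<in> carrier Y" "f t \<in> carrier Y"
        by simp_all
      \<comment> \<open>Let s \<preceq> t with s \<noteq> t. If g (f s) \<noteq> g (f t), then f s
        \<noteq> f t, and f s \<preceq> f t by monotonicity, so both sides read A at the same place.
        If g (f s) = g (f t), both sides are 0, whether the points are merged by f or only by
        g.\<close>
      show "matrix_map P X Z ?gf A (s, t) = matrix_map P X Y f (matrix_map P Y Z g A) (s, t)"
        using f.f_leq[of s t]
        by (auto simp: gf.map_entry[OF A st] f.map_entry[OF g.map_closed[OF A] st]
            g.map_entry[OF A] fst gf st)
    qed (intro gf.map_closed f.map_closed g.map_closed A)+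
    then show "matrix_map P X Z ?gf = cat_comp TopRings (matrix_ring P Z) (matrix_ring P Y)
        (matrix_ring P X) (matrix_map P X Y f) (matrix_map P Y Z g)"
      by (intro extensionalityI[OF gf.map_extensional]) (simp_all add: TopRings_def compose_def)
  qed
qed

end
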